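(* Let $(A,\mu_1,\mu_2)$ be a compatible associative algebra, $N\ge1$ a natural number, and let $(\mu_{1,t}^N=\sum_{i=0}^Nt^i\mu_{1,i},\ \mu_{2,t}^N=\sum_{i=0}^Nt^i\mu_{2,i})$ be an order $N$ deformation of $A$. Then the obstruction cochain $$Ob_{(\mu_{1,t}^N,\mu_{2,t}^N)}=-\frac12\sum_{i+j=N+1;\ i,j\geq1}[\![(\mu_{1,i},\mu_{2,i}),(\mu_{1,j},\mu_{2,j})]\!]\in C^3_c(A,A)$$ is a $3$-cocycle, i.e. $\delta_c\big(Ob_{(\mu_{1,t}^N,\mu_{2,t}^N)}\big)=0$.
   Context: All vector spaces are finite-dimensional over a field $\mathbb{K}$ of characteristic $0$. A compatible associative algebra is a triple $(A,\mu_1,\mu_2)$ of a vector space with two associative bilinear products, written $a\cdot_1 b$ and $a\cdot_2 b$, with $(a\cdot_1 b)\cdot_2 c+(a\cdot_2 b)\cdot_1 c=a\cdot_1(b\cdot_2 c)+a\cdot_2(b\cdot_1 c)$ for all $a,b,c$ (and similarly over a commutative ring). Let $C^n(A,A)=\mathrm{Hom}(A^{\otimes n},A)$ and $C^n_c(A,A)=C^n(A,A)^{\oplus n}$ for $n\ge1$. The Gerstenhaber bracket of $f\in C^{m+1}(A,A)$, $g\in C^{n+1}(A,A)$ is $[f,g]_G=f\diamond g-(-1)^{mn}g\diamond f$, where $(f\diamond g)(a_1,\ldots,a_{m+n+1})=\sum_{i=1}^{m+1}(-1)^{(i-1)n}f(a_1,\ldots,a_{i-1},g(a_i,\ldots,a_{i+n}),\ldots,a_{m+n+1})$.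 The bracket $[\![~,~]\!]:C^{m+1}_c(A,A)\times C^{n+1}_c(A,A)\to C^{m+n+1}_c(A,A)$ sends $((f_1,\ldots,f_{m+1}),(g_1,\ldots,g_{n+1}))$ to the tuple with $i$-th entry $\sum_{q+r=i+1}[f_q,g_r]_G$ ($1\le q\le m+1$, $1\le r\le n+1$). The coboundary is $\delta_c(f_1,\ldots,f_n)=(-1)^{n-1}[\![(\mu_1,\mu_2),(f_1,\ldots,f_n)]\!]$ for $n\geq1$; equivalently $\delta_c(f_1,\ldots,f_n)=(\delta_1f_1,\ldots,\delta_1f_i+\delta_2f_{i-1},\ldots,\delta_2f_n)$ with $\delta_1,\delta_2$ the Hochschild coboundaries of $(A,\mu_1)$, $(A,\mu_2)$ with coefficients in themselves. An order $N$ deformation of $A$ is a pair of polynomials $\mu_{1,t}^N=\sum_{i=0}^Nt^i\mu_{1,i}$, $\mu_{2,t}^N=\sum_{i=0}^Nt^i\mu_{2,i}$, with $\mu_{1,i},\mu_{2,i}$ bilinear maps on $A$, $\mu_{1,0}=\mu_1$, $\mu_{2,0}=\mu_2$, such that $(A[[t]]/(t^{N+1}),\mu_{1,t}^N,\mu_{2,t}^N)$ is a compatible associative algebra over $\mathbb{K}[[t]]/(t^{N+1})$. *)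

theory Defs
  imports
    "HOL-Algebra.Algebraic_Closure_Type"
    "HOL-Computational_Algebra.Formal_Power_Series"
    "HOL-Library.Function_Algebras"
begin

section \<open>Compatible associative algebras over a commutative ring\<close>

definition bilinear_product ::
  "('r, 'x) ring_scheme \<Rightarrow> ('r, 'm, 'y) module_scheme \<Rightarrow> ('m \<Rightarrow> 'm \<Rightarrow> 'm) \<Rightarrow> bool" where
  "bilinear_product R M f \<longleftrightarrow>
     (\<forall>x\<in>carrier M. \<forall>y\<in>carrier M. f x y \<in> carrier M) \<and>
     (\<forall>x\<in>carrier M. \<forall>y\<in>carrier M. \<forall>z\<in>carrier M.
        f (x \<oplus>\<^bsub>M\<^esub> y) z = f x z \<oplus>\<^bsub>M\<^esub> f y z \<and> f z (x \<oplus>\<^bsub>M\<^esub> y) = f z x \<oplus>\<^bsub>M\<^esub> f z y) \<and>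
     (\<forall>r\<in>carrier R. \<forall>x\<in>carrier M. \<forall>y\<in>carrier M.
        f (r \<odot>\<^bsub>M\<^esub> x) y = r \<odot>\<^bsub>M\<^esub> f x y \<and> f x (r \<odot>\<^bsub>M\<^esub> y) = r \<odot>\<^bsub>M\<^esub> f x y)"

text \<open>
  The fields \<open>mult\<close> and \<open>one\<close> of the module record play no role here: the two products are
  separate parameters.
\<close>

locale compatible_algebra = Module.module R M
  for R :: "('r, 'x) ring_scheme" and M :: "('r, 'm, 'y) module_scheme" (structure) +
  fixes m1 m2 :: "'m \<Rightarrow> 'm \<Rightarrow> 'm"
  assumes bilinear1: "bilinear_product R M m1"
    and bilinear2: "bilinear_product R M m2"
    and assoc1: "\<lbrakk>a \<in> carrier M; b \<in> carrier M; c \<in> carrier M\<rbrakk> \<Longrightarrow>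
          m1 (m1 a b) c = m1 a (m1 b c)"
    and assoc2: "\<lbrakk>a \<in> carrier M; b \<in> carrier M; c \<in> carrier M\<rbrakk> \<Longrightarrow>
          m2 (m2 a b) c = m2 a (m2 b c)"
    and compatible: "\<lbrakk>a \<in> carrier M; b \<in> carrier M; c \<in> carrier M\<rbrakk> \<Longrightarrow>
          m2 (m1 a b) c \<oplus>\<^bsub>M\<^esub> m1 (m2 a b) c = m1 a (m2 b c) \<oplus>\<^bsub>M\<^esub> m2 a (m1 b c)"

definition module_of :: "('k \<Rightarrow> 'a \<Rightarrow> 'a) \<Rightarrow> ('k, 'a::ab_group_add) module" where
  "module_of scale = \<lparr>carrier = UNIV, monoid.mult = undefined, one = undefined,
     ring.zero = 0, add = (+), module.smult = scale\<rparr>"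


section \<open>Cochains and the bracket\<close>

text \<open>
  An \<open>n\<close>-cochain, i.e. a linear map \<open>A\<^sup>\<otimes>\<^sup>n \<rightarrow> A\<close>, is an \<open>n\<close>-linear map on lists of length \<open>n\<close>,
  with value \<open>0\<close> on lists of any other length, so that equality of cochains is equality of functions.
\<close>

definition cochains :: "('k::field \<Rightarrow> 'a \<Rightarrow> 'a::ab_group_add) \<Rightarrow> nat \<Rightarrow> ('a list \<Rightarrow> 'a) set" where
  "cochains scale n = {f.
     (\<forall>xs ys. length xs + 1 + length ys = n \<longrightarrow>
        Vector_Spaces.linear scale scale (\<lambda>x. f (xs @ x # ys))) \<and>
     (\<forall>xs. length xs \<noteq> n \<longrightarrow> f xs = 0)}"

text \<open>
  An element \<open>(F 1, \<dots>, F n)\<close> of \<open>C\<^sub>c\<^sup>n\<close> is a function on indices, zero outside \<open>{1..n}\<close>.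
\<close>

definition compat_cochains ::
  "('k::field \<Rightarrow> 'a \<Rightarrow> 'a::ab_group_add) \<Rightarrow> nat \<Rightarrow> (nat \<Rightarrow> 'a list \<Rightarrow> 'a) set" where
  "compat_cochains scale n =
     {F. (\<forall>i\<in>{1..n}. F i \<in> cochains scale n) \<and> (\<forall>i. i \<notin> {1..n} \<longrightarrow> F i = 0)}"

text \<open>
  In the next three definitions \<open>f\<close>, \<open>F\<close> have degree \<open>m + 1\<close> and \<open>g\<close>, \<open>G\<close> have degree \<open>n + 1\<close>.
\<close>

definition gerst_circ ::
  "('k::field \<Rightarrow> 'a \<Rightarrow> 'a::ab_group_add) \<Rightarrow> nat \<Rightarrow> nat \<Rightarrow>
     ('a list \<Rightarrow> 'a) \<Rightarrow> ('a list \<Rightarrow> 'a) \<Rightarrow> 'a list \<Rightarrow> 'a" where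
  "gerst_circ scale m n f g = (\<lambda>xs.
     if length xs = m + n + 1
     then \<Sum>i = 1..m+1. scale ((- 1) ^ ((i - 1) * n))
            (f (take (i - 1) xs @ [g (take (n + 1) (drop (i - 1) xs))] @ drop (i + n) xs))
     else 0)"

definition gerst_bracket ::
  "('k::field \<Rightarrow> 'a \<Rightarrow> 'a::ab_group_add) \<Rightarrow> nat \<Rightarrow> nat \<Rightarrow>
     ('a list \<Rightarrow> 'a) \<Rightarrow> ('a list \<Rightarrow> 'a) \<Rightarrow> 'a list \<Rightarrow> 'a" where
  "gerst_bracket scale m n f g = (\<lambda>xs.
     gerst_circ scale m n f g xs - scale ((- 1) ^ (m * n)) (gerst_circ scale n m g f xs))"

definition compat_bracket ::
  "('k::field \<Rightarrow> 'a \<Rightarrow> 'a::ab_group_add) \<Rightarrow> nat \<Rightarrow> nat \<Rightarrow>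
     (nat \<Rightarrow> 'a list \<Rightarrow> 'a) \<Rightarrow> (nat \<Rightarrow> 'a list \<Rightarrow> 'a) \<Rightarrow> nat \<Rightarrow> 'a list \<Rightarrow> 'a" where
  "compat_bracket scale m n F G = (\<lambda>i.
     \<Sum>(q, r) \<in> {(q, r). q \<in> {1..m+1} \<and> r \<in> {1..n+1} \<and> q + r = i + 1}.
       gerst_bracket scale m n (F q) (G r))"

definition cochain_pair ::
  "('a \<Rightarrow> 'a \<Rightarrow> 'a) \<Rightarrow> ('a \<Rightarrow> 'a \<Rightarrow> 'a) \<Rightarrow> nat \<Rightarrow> 'a list \<Rightarrow> 'a::ab_group_add" where
  "cochain_pair m1 m2 = (\<lambda>i xs.
     if length xs \<noteq> 2 then 0
     else if i = 1 then m1 (xs ! 0) (xs ! 1)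
     else if i = 2 then m2 (xs ! 0) (xs ! 1)
     else 0)"

text \<open>Meaningful for \<open>n \<ge> 1\<close> only; \<open>F\<close> has degree \<open>n\<close>.\<close>

definition compat_coboundary ::
  "('k::field \<Rightarrow> 'a \<Rightarrow> 'a::ab_group_add) \<Rightarrow> ('a \<Rightarrow> 'a \<Rightarrow> 'a) \<Rightarrow> ('a \<Rightarrow> 'a \<Rightarrow> 'a) \<Rightarrow> nat \<Rightarrow>
     (nat \<Rightarrow> 'a list \<Rightarrow> 'a) \<Rightarrow> nat \<Rightarrow> 'a list \<Rightarrow> 'a" where
  "compat_coboundary scale m1 m2 n F = (\<lambda>i xs.
     scale ((- 1) ^ (n - 1)) (compat_bracket scale 1 (n - 1) (cochain_pair m1 m2) F i xs))"


section \<open>Deformations of finite order\<close>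

text \<open>\<open>A[[t]]\<close> over \<open>K[[t]]\<close>: the sequence \<open>x\<close> stands for \<open>\<Sum>n. t\<^sup>n x n\<close>.\<close>

definition pser_module ::
  "('k::field \<Rightarrow> 'a \<Rightarrow> 'a::ab_group_add) \<Rightarrow> ('k fps, nat \<Rightarrow> 'a) module" where
  "pser_module scale = module_of (\<lambda>p x n. \<Sum>i\<le>n. scale (fps_nth p i) (x (n - i)))"

text \<open>Quotient of a module by a submodule, in the style of \<^const>\<open>FactRing\<close>.\<close>

definition FactModule ::
  "('r, 'm, 'y) module_scheme \<Rightarrow> 'm set \<Rightarrow> ('r set, 'm set) module" where
  "FactModule M H = \<lparr>carrier = a_rcosets\<^bsub>M\<^esub> H, monoid.mult = undefined, one = undefined,
     ring.zero = H, add = set_add M,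
     module.smult = (\<lambda>P S. \<Union>p\<in>P. \<Union>x\<in>S. H +>\<^bsub>M\<^esub> (p \<odot>\<^bsub>M\<^esub> x))\<rparr>"

definition quot_product ::
  "('r, 'm, 'y) module_scheme \<Rightarrow> 'm set \<Rightarrow> ('m \<Rightarrow> 'm \<Rightarrow> 'm) \<Rightarrow> 'm set \<Rightarrow> 'm set \<Rightarrow> 'm set" where
  "quot_product M H f S T = (\<Union>x\<in>S. \<Union>y\<in>T. H +>\<^bsub>M\<^esub> (f x y))"

definition trunc_ring :: "nat \<Rightarrow> 'k::field fps set ring" where
  "trunc_ring N = ring_of_type_algebra Quot (PIdl\<^bsub>ring_of_type_algebra\<^esub> (fps_X ^ (N + 1)))"

text \<open>The submodule \<open>t\<^sup>N\<^sup>+\<^sup>1 A[[t]]\<close> and the quotient \<open>A[[t]]/(t\<^sup>N\<^sup>+\<^sup>1)\<close>.\<close>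

definition tpow_submodule ::
  "('k::field \<Rightarrow> 'a \<Rightarrow> 'a::ab_group_add) \<Rightarrow> nat \<Rightarrow> (nat \<Rightarrow> 'a) set" where
  "tpow_submodule scale N = range (\<lambda>x. fps_X ^ (N + 1) \<odot>\<^bsub>pser_module scale\<^esub> x)"

definition trunc_module ::
  "('k::field \<Rightarrow> 'a \<Rightarrow> 'a::ab_group_add) \<Rightarrow> nat \<Rightarrow> ('k fps set, (nat \<Rightarrow> 'a) set) module" where
  "trunc_module scale N = FactModule (pser_module scale) (tpow_submodule scale N)"

text \<open>The extension of \<open>\<Sum>i\<le>N. t\<^sup>i \<mu> i\<close> to a \<open>K[[t]]\<close>-bilinear product on \<open>A[[t]]\<close>.\<close>

definition pser_product ::
  "nat \<Rightarrow> (nat \<Rightarrow> 'a \<Rightarrow> 'a \<Rightarrow> 'a) \<Rightarrow> (nat \<Rightarrow> 'a) \<Rightarrow> (nat \<Rightarrow> 'a) \<Rightarrow> nat \<Rightarrow> 'a::ab_group_add" where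
  "pser_product N \<mu> x y = (\<lambda>n.
     \<Sum>(i, j, k) \<in> {(i, j, k). i \<le> N \<and> i + j + k = n}. \<mu> i (x j) (y k))"

definition trunc_product ::
  "('k::field \<Rightarrow> 'a \<Rightarrow> 'a::ab_group_add) \<Rightarrow> nat \<Rightarrow> (nat \<Rightarrow> 'a \<Rightarrow> 'a \<Rightarrow> 'a) \<Rightarrow>
     (nat \<Rightarrow> 'a) set \<Rightarrow> (nat \<Rightarrow> 'a) set \<Rightarrow> (nat \<Rightarrow> 'a) set" where
  "trunc_product scale N \<mu> =
     quot_product (pser_module scale) (tpow_submodule scale N) (pser_product N \<mu>)"

text \<open>Only the maps \<open>\<mu>1 i\<close>, \<open>\<mu>2 i\<close> with \<open>i \<le> N\<close> matter.\<close>

definition order_deformation ::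
  "('k::field \<Rightarrow> 'a \<Rightarrow> 'a::ab_group_add) \<Rightarrow> ('a \<Rightarrow> 'a \<Rightarrow> 'a) \<Rightarrow> ('a \<Rightarrow> 'a \<Rightarrow> 'a) \<Rightarrow> nat \<Rightarrow>
     (nat \<Rightarrow> 'a \<Rightarrow> 'a \<Rightarrow> 'a) \<Rightarrow> (nat \<Rightarrow> 'a \<Rightarrow> 'a \<Rightarrow> 'a) \<Rightarrow> bool" where
  "order_deformation scale m1 m2 N \<mu>1 \<mu>2 \<longleftrightarrow>
     (\<forall>i\<le>N. bilinear_product (ring_of_type_algebra :: 'k ring) (module_of scale) (\<mu>1 i) \<and>
            bilinear_product (ring_of_type_algebra :: 'k ring) (module_of scale) (\<mu>2 i)) \<and>
     \<mu>1 0 = m1 \<and> \<mu>2 0 = m2 \<and>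
     compatible_algebra (trunc_ring N) (trunc_module scale N)
       (trunc_product scale N \<mu>1) (trunc_product scale N \<mu>2)"

definition obstruction ::
  "('k::field_char_0 \<Rightarrow> 'a \<Rightarrow> 'a::ab_group_add) \<Rightarrow> nat \<Rightarrow>
     (nat \<Rightarrow> 'a \<Rightarrow> 'a \<Rightarrow> 'a) \<Rightarrow> (nat \<Rightarrow> 'a \<Rightarrow> 'a \<Rightarrow> 'a) \<Rightarrow> nat \<Rightarrow> 'a list \<Rightarrow> 'a" where
  "obstruction scale N \<mu>1 \<mu>2 = (\<lambda>k xs. scale (- (1 / 2))
     ((\<Sum>(i, j) \<in> {(i, j). i + j = N + 1 \<and> i \<ge> 1 \<and> j \<ge> 1}.
         compat_bracket scale 1 1 (cochain_pair (\<mu>1 i) (\<mu>2 i)) (cochain_pair (\<mu>1 j) (\<mu>2 j))) k xs))"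

end

theory Submission
  imports Defs
begin

text \<open>
  Write \<open>\<phi> (i, p)\<close> for the coefficient of \<open>t\<^sup>i\<close> in the \<open>p\<close>-th deformed product (\<open>p = 1, 2\<close>), and think of
  all of them together as one product \<open>\<Sum> t\<^sup>i s\<^sup>p \<phi> (i, p)\<close> with a second formal parameter \<open>s\<close>. The pair
  of products is compatible associative exactly when this one product is associative, and the bracket
  of tuples is the Gerstenhaber bracket with the powers of \<open>s\<close> recorded as positions in the tuple.
  So the claim is the bigraded form of the classical fact that the obstruction to extending a
  deformation of an associative algebra is a Hochschild cocycle.

  Write \<open>f \<circ> g\<close> for the trilinear map \<open>f (g a b) c - f a (g b c)\<close>, and \<open>D (n, k)\<close> for the sum of \<open>\<phi> x \<circ> \<phi> y\<close> over all \<open>x\<close>, \<open>y\<close> of total \<open>t\<close>-degree \<open>n\<close> and total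
  \<open>s\<close>-degree \<open>k + 1\<close>, the products of \<open>t\<close>-degree above \<open>N\<close> being left out. Three facts give the theorem.
  \<^item> The axioms modulo \<open>t\<^sup>N\<^sup>+\<^sup>1\<close>, evaluated on constant series, say that \<open>D (n, k) = 0\<close> for \<open>n \<le> N\<close>
    (\<open>compatible_trunc_imp_coeffs\<close>, \<open>low_order_associators_cancel\<close>).
  \<^item> The \<open>k\<close>-th entry of the obstruction is \<open>- D (N + 1, k)\<close>: leaving out \<open>i > N\<close> is the same as requiring
    \<open>i, j \<ge> 1\<close> when \<open>i + j = N + 1\<close>, and the factor \<open>1 / 2\<close> cancels the symmetrisation in the bracket
    (\<open>obstruction_eq\<close>).
  \<^item> Summed over all triples of fixed total degree, the brackets \<open>[\<phi> x, \<phi> y \<circ> \<phi> z]\<close> add up to zero. This is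
    the cubic Jacobi identity \<open>[\<phi>, [\<phi>, \<phi>]] = 0\<close> (\<open>hochschild_associator_sum_eq_0\<close>).

  In the last sum the terms with \<open>x\<close> of \<open>t\<close>-degree \<open>i \<ge> 1\<close> contain \<open>D (N + 1 - i, k)\<close>, hence vanish; what is
  left are the brackets of the undeformed products with \<open>D (N + 1, k)\<close>, that is, up to sign, the
  coboundary of the obstruction.
\<close>

lemma sum_apply: "(\<Sum>i\<in>I. F i) x = (\<Sum>i\<in>I. F i x)"
  by (induction I rule: infinite_finite_induct) auto

section \<open>The cubic Jacobi identity for families of products\<close>

definition associator :: "('a \<Rightarrow> 'a \<Rightarrow> 'a) \<Rightarrow> ('a \<Rightarrow> 'a \<Rightarrow> 'a) \<Rightarrow> 'a \<Rightarrow> 'a \<Rightarrow> 'a \<Rightarrow> 'a::ab_group_add" where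
  "associator f g a b c = f (g a b) c - f a (g b c)"

text \<open>
  The Gerstenhaber bracket of a bilinear map and a trilinear one; for an associative product \<open>f\<close> this
  is the Hochschild coboundary of \<open>g\<close>.
\<close>

definition hochschild ::
  "('a \<Rightarrow> 'a \<Rightarrow> 'a) \<Rightarrow> ('a \<Rightarrow> 'a \<Rightarrow> 'a \<Rightarrow> 'a) \<Rightarrow> 'a \<Rightarrow> 'a \<Rightarrow> 'a \<Rightarrow> 'a \<Rightarrow> 'a::ab_group_add" where
  "hochschild f g a b c d =
     f (g a b c) d + f a (g b c d) - g (f a b) c d + g a (f b c) d - g a b (f c d)"

definition biadditive :: "('a::ab_group_add \<Rightarrow> 'a \<Rightarrow> 'a) \<Rightarrow> bool" where
  "biadditive f \<longleftrightarrow> (\<forall>b. additive (\<lambda>a. f a b)) \<and> (\<forall>a. additive (f a))"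

lemma biadditiveD:
  assumes "biadditive f"
  shows "f 0 b = 0" "f a 0 = 0" "f (- x) b = - f x b" "f a (- x) = - f a x" "f (x - y) b = f x b - f y b" "f a (x - y) = f a x - f a y"
    "f (\<Sum>i\<in>I. h i) b = (\<Sum>i\<in>I. f (h i) b)" "f a (\<Sum>i\<in>I. h i) = (\<Sum>i\<in>I. f a (h i))"
proof -
  interpret l: additive "\<lambda>a. f a b" using assms by (simp add: biadditive_def)
  interpret r: additive "f a" using assms by (simp add: biadditive_def)
  show "f 0 b = 0" "f a 0 = 0" "f (- x) b = - f x b" "f a (- x) = - f a x" "f (x - y) b = f x b - f y b" "f a (x - y) = f a x - f a y"
    "f (\<Sum>i\<in>I. h i) b = (\<Sum>i\<in>I. f (h i) b)" "f a (\<Sum>i\<in>I. h i) = (\<Sum>i\<in>I. f a (h i))"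
    by (rule l.zero r.zero l.minus r.minus l.diff r.diff l.sum r.sum)+
qed

lemma sum_swap_triple:
  assumes "\<And>x y z. (x, y, z) \<in> T \<Longrightarrow> (z, y, x) \<in> T"
  shows "(\<Sum>(x, y, z)\<in>T. h x y z) = (\<Sum>(x, y, z)\<in>T. h z y x)"
  by (rule sum.reindex_bij_witness[of _ "\<lambda>(x, y, z). (z, y, x)" "\<lambda>(x, y, z). (z, y, x)"])
    (use assms in auto)

lemma sum_rotate_triple:
  assumes "\<And>x y z. (x, y, z) \<in> T \<Longrightarrow> (y, z, x) \<in> T"
  shows "(\<Sum>(x, y, z)\<in>T. h x y z) = (\<Sum>(x, y, z)\<in>T. h y z x)"
proof -
  have rotate: "(y, z, x) \<in> T" "(z, x, y) \<in> T" if "(x, y, z) \<in> T" for x y z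
    using assms that by blast+
  show ?thesis
    by (rule sum.reindex_bij_witness[of _ "\<lambda>(x, y, z). (y, z, x)" "\<lambda>(x, y, z). (z, x, y)"])
      (auto intro: rotate)
qed

text \<open>
  Expanding the bracket gives ten monomials: each of the five ways to bracket \<open>a b c d\<close> occurs twice,
  with opposite signs and with the three indices permuted. So the two occurrences cancel in the sum
  over a set of triples that is closed under permutations.
\<close>

lemma hochschild_associator_sum_eq_0:
  assumes add: "\<And>x y z. (x, y, z) \<in> T \<Longrightarrow> biadditive (\<phi> x)"
    and swap: "\<And>x y z. (x, y, z) \<in> T \<Longrightarrow> (z, y, x) \<in> T"
    and rotate: "\<And>x y z. (x, y, z) \<in> T \<Longrightarrow> (y, z, x) \<in> T"
  shows "(\<Sum>(x, y, z)\<in>T. hochschild (\<phi> x) (associator (\<phi> y) (\<phi> z)) a b c d) = 0"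
proof -
  \<comment> \<open>The five bracketings of \<open>a b c d\<close>. In the balanced one, \<open>E\<close>, the two occurrences differ by a
    transposition of the indices, in the other four by a rotation.\<close>
  define A where "A = (\<lambda>x y z. \<phi> x (\<phi> y (\<phi> z a b) c) d)"
  define B where "B = (\<lambda>x y z. \<phi> x (\<phi> y a (\<phi> z b c)) d)"
  define C where "C = (\<lambda>x y z. \<phi> x a (\<phi> y (\<phi> z b c) d))"
  define D where "D = (\<lambda>x y z. \<phi> x a (\<phi> y b (\<phi> z c d)))"
  define E where "E = (\<lambda>x y z. \<phi> y (\<phi> x a b) (\<phi> z c d))"
  have "(\<Sum>(x, y, z)\<in>T. hochschild (\<phi> x) (associator (\<phi> y) (\<phi> z)) a b c d) =
     (\<Sum>(x, y, z)\<in>T. (A x y z - A y z x) - (B x y z - B y z x) + (C x y z - C y z x)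
         - (D x y z - D y z x) + (E x y z - E z y x))"
    by (intro sum.cong refl)
      (auto simp: hochschild_def associator_def biadditiveD[OF add] A_def B_def C_def D_def E_def)
  also have "\<dots> = 0"
    using sum_rotate_triple[OF rotate, where h = A] sum_rotate_triple[OF rotate, where h = B]
      sum_rotate_triple[OF rotate, where h = C] sum_rotate_triple[OF rotate, where h = D]
      sum_swap_triple[OF swap, where h = E]
    by (simp add: case_prod_unfold sum.distrib sum_subtractf)
  finally show ?thesis .
qed

lemma hochschild_sum:
  assumes "biadditive f"
  shows "hochschild f (\<lambda>a b c. \<Sum>i\<in>I. g i a b c) a b c d = (\<Sum>i\<in>I. hochschild f (g i) a b c d)"
  by (simp add: hochschild_def biadditiveD[OF assms] sum.distrib sum_subtractf)

section \<open>Coefficients of the truncated axioms\<close>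

text \<open>The coset of \<open>x\<close> modulo \<open>t\<^sup>N\<^sup>+\<^sup>1\<close>, described by the coefficients that it determines.\<close>

definition jet_class :: "nat \<Rightarrow> (nat \<Rightarrow> 'a) \<Rightarrow> (nat \<Rightarrow> 'a) set" where
  "jet_class N x = {y. \<forall>n\<le>N. y n = x n}"

lemma jet_class_eq_iff: "jet_class N x = jet_class N y \<longleftrightarrow> (\<forall>n\<le>N. x n = y n)"
  by (auto simp: jet_class_def set_eq_iff)

lemma tpow_submodule_eq:
  fixes scale :: "'k::field \<Rightarrow> 'a::ab_group_add \<Rightarrow> 'a"
  assumes "vector_space scale"
  shows "tpow_submodule scale N = jet_class N 0"
proof -
  interpret vector_space scale by fact
  have shift: "fps_X ^ (N + 1) \<odot>\<^bsub>pser_module scale\<^esub> x = (\<lambda>n. if n \<le> N then 0 else x (n - (N + 1)))" for x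
  proof
    fix n
    have "(fps_X ^ (N + 1) \<odot>\<^bsub>pser_module scale\<^esub> x) n =
        (\<Sum>i\<le>n. scale (fps_nth (fps_X ^ (N + 1)) i) (x (n - i)))"
      by (simp add: pser_module_def module_of_def del: power_Suc)
    also have "\<dots> = (\<Sum>i\<le>n. if i = N + 1 then x (n - i) else 0)"
      by (intro sum.cong refl) (auto simp del: power_Suc)
    finally have "(fps_X ^ (N + 1) \<odot>\<^bsub>pser_module scale\<^esub> x) n =
        (\<Sum>i\<le>n. if i = N + 1 then x (n - i) else 0)" .
    then show "(fps_X ^ (N + 1) \<odot>\<^bsub>pser_module scale\<^esub> x) n = (if n \<le> N then 0 else x (n - (N + 1)))"
      by (auto simp: sum.delta)
  qed
  show ?thesis
  proof (intro equalityI subsetI)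
    fix y assume "y \<in> tpow_submodule scale N"
    then show "y \<in> jet_class N 0"
      unfolding tpow_submodule_def shift by (auto simp: jet_class_def)
  next
    fix y :: "nat \<Rightarrow> 'a"
    assume "y \<in> jet_class N 0"
    then have "y = (\<lambda>n. if n \<le> N then 0 else (\<lambda>m. y (m + (N + 1))) (n - (N + 1)))"
      by (auto simp: jet_class_def)
    then show "y \<in> tpow_submodule scale N"
      unfolding tpow_submodule_def shift
      by (rule image_eqI[where x = "\<lambda>m. y (m + (N + 1))"]) (rule UNIV_I)
  qed
qed

lemma pser_coset:
  assumes "vector_space scale"
  shows "tpow_submodule scale N +>\<^bsub>pser_module scale\<^esub> x = jet_class N x"
proof -
  have "y \<in> jet_class N x \<longleftrightarrow> (\<exists>h\<in>jet_class N 0. y = h + x)" for y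
    by (auto simp: jet_class_def intro!: exI[of _ "y - x"])
  then show ?thesis
    unfolding tpow_submodule_eq[OF assms] a_r_coset_def'
    by (auto simp: pser_module_def module_of_def)
qed

lemma trunc_carrier:
  assumes "vector_space scale"
  shows "carrier (trunc_module scale N) = range (jet_class N)"
proof -
  have "carrier (pser_module scale) = UNIV"
    by (simp add: pser_module_def module_of_def)
  then show ?thesis
    by (auto simp: trunc_module_def FactModule_def A_RCOSETS_def' pser_coset[OF assms])
qed

lemma trunc_add:
  assumes "vector_space scale"
  shows "jet_class N x \<oplus>\<^bsub>trunc_module scale N\<^esub> jet_class N y = jet_class N (x + y)"
proof -
  have "z \<in> jet_class N (x + y) \<longleftrightarrow> (\<exists>h\<in>jet_class N x. \<exists>k\<in>jet_class N y. z = h + k)" for z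
  proof
    assume "z \<in> jet_class N (x + y)"
    then have "z - x \<in> jet_class N y" "x \<in> jet_class N x" "z = x + (z - x)"
      by (auto simp: jet_class_def)
    then show "\<exists>h\<in>jet_class N x. \<exists>k\<in>jet_class N y. z = h + k" by blast
  qed (auto simp: jet_class_def)
  then show ?thesis
    unfolding trunc_module_def FactModule_def 
    by (auto simp: set_add_def' pser_module_def module_of_def)
qed

text \<open>
  The product of two cosets is a union of cosets. That it is a single one need not be computed:
  bilinearity includes that the product lies in the carrier, so it is some coset, and it contains
  the product of the representatives.
\<close>

lemma trunc_product_jet_class:
  assumes vs: "vector_space scale"
    and bil: "bilinear_product R (trunc_module scale N) (trunc_product scale N \<mu>)"
  shows "trunc_product scale N \<mu> (jet_class N x) (jet_class N y) = jet_class N (pser_product N \<mu> x y)"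
proof -
  let ?P = "trunc_product scale N \<mu> (jet_class N x) (jet_class N y)"
  have "?P \<in> range (jet_class N)"
    using bil by (auto simp: bilinear_product_def trunc_carrier[OF vs])
  then obtain p where p: "?P = jet_class N p" by auto
  have "x \<in> jet_class N x" "y \<in> jet_class N y" by (auto simp: jet_class_def)
  then have "jet_class N (pser_product N \<mu> x y) \<subseteq> ?P"
    unfolding trunc_product_def quot_product_def pser_coset[OF vs] by blast
  then have "pser_product N \<mu> x y \<in> jet_class N p" using p by (auto simp: jet_class_def)
  then show ?thesis using p by (auto simp: jet_class_def)
qed

definition const_series :: "'a \<Rightarrow> nat \<Rightarrow> 'a::zero" where
  "const_series a n = (if n = 0 then a else 0)"

lemma pser_product_const_right:
  assumes "\<And>i. i \<le> N \<Longrightarrow> biadditive (\<mu> i)" and "n \<le> N"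
  shows "pser_product N \<mu> x (const_series c) n = (\<Sum>(i, j)\<in>{(i, j). i + j = n}. \<mu> i (x j) c)"
proof -
  have fin: "finite {(i, j, k). i \<le> N \<and> i + j + k = n}"
    by (rule finite_subset[of _ "{..n} \<times> {..n} \<times> {..n}"]) auto
  have "(\<Sum>(i, j)\<in>{(i, j). i + j = n}. \<mu> i (x j) c) =
      (\<Sum>(i, j, k)\<in>{(i, j, k). i \<le> N \<and> i + j + k = n \<and> k = 0}. \<mu> i (x j) (const_series c k))"
    by (rule sum.reindex_bij_witness[of _ "\<lambda>(i, j, k). (i, j)" "\<lambda>(i, j). (i, j, 0)"])
      (use \<open>n \<le> N\<close> in \<open>auto simp: const_series_def\<close>)
  also have "\<dots> = pser_product N \<mu> x (const_series c) n"
    unfolding pser_product_def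
    by (rule sum.mono_neutral_left)
      (use fin in \<open>auto simp: const_series_def biadditiveD[OF assms(1)] split: if_splits\<close>)
  finally show ?thesis ..
qed

lemma pser_product_const_left:
  assumes "\<And>i. i \<le> N \<Longrightarrow> biadditive (\<mu> i)" and "n \<le> N"
  shows "pser_product N \<mu> (const_series a) y n = (\<Sum>(i, j)\<in>{(i, j). i + j = n}. \<mu> i a (y j))"
proof -
  have fin: "finite {(i, j, k). i \<le> N \<and> i + j + k = n}"
    by (rule finite_subset[of _ "{..n} \<times> {..n} \<times> {..n}"]) auto
  have "(\<Sum>(i, j)\<in>{(i, j). i + j = n}. \<mu> i a (y j)) =
      (\<Sum>(i, j, k)\<in>{(i, j, k). i \<le> N \<and> i + j + k = n \<and> j = 0}. \<mu> i (const_series a j) (y k))"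
    by (rule sum.reindex_bij_witness[of _ "\<lambda>(i, j, k). (i, k)" "\<lambda>(i, j). (i, 0, j)"])
      (use \<open>n \<le> N\<close> in \<open>auto simp: const_series_def\<close>)
  also have "\<dots> = pser_product N \<mu> (const_series a) y n"
    unfolding pser_product_def
    by (rule sum.mono_neutral_left)
      (use fin in \<open>auto simp: const_series_def biadditiveD[OF assms(1)] split: if_splits\<close>)
  finally show ?thesis ..
qed

lemma pser_product_const_const:
  assumes "\<And>i. i \<le> N \<Longrightarrow> biadditive (\<mu> i)" and "n \<le> N"
  shows "pser_product N \<mu> (const_series a) (const_series b) n = \<mu> n a b"
proof -
  have "finite {(i, j). i + j = n}"
    by (rule finite_subset[of _ "{..n} \<times> {..n}"]) auto
  then have "(\<Sum>(i, j)\<in>{(i, j). i + j = n}. \<mu> i (const_series a j) b) =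
      (\<Sum>(i, j)\<in>{(n, 0)}. \<mu> i (const_series a j) b)"
    by (rule sum.mono_neutral_right)
      (use assms in \<open>auto simp: const_series_def biadditiveD[OF assms(1)] split: if_splits\<close>)
  then show ?thesis
    using pser_product_const_right[OF assms] by (simp add: const_series_def)
qed

text \<open>
  The coefficient of \<open>t\<^sup>n\<close> in the associator of the power series products with coefficients \<open>\<mu>\<close> and \<open>\<nu>\<close>,
  on constant series.
\<close>

definition assoc_coeff ::
  "(nat \<Rightarrow> 'a \<Rightarrow> 'a \<Rightarrow> 'a) \<Rightarrow> (nat \<Rightarrow> 'a \<Rightarrow> 'a \<Rightarrow> 'a) \<Rightarrow> nat \<Rightarrow> 'a \<Rightarrow> 'a \<Rightarrow> 'a \<Rightarrow> 'a::ab_group_add" where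
  "assoc_coeff \<mu> \<nu> n a b c = (\<Sum>(i, j)\<in>{(i, j). i + j = n}. associator (\<mu> i) (\<nu> j) a b c)"

lemma assoc_coeff_pser_product:
  assumes \<mu>: "\<And>i. i \<le> N \<Longrightarrow> biadditive (\<mu> i)" and \<nu>: "\<And>i. i \<le> N \<Longrightarrow> biadditive (\<nu> i)" and "n \<le> N"
  shows "assoc_coeff \<mu> \<nu> n a b c =
    pser_product N \<mu> (pser_product N \<nu> (const_series a) (const_series b)) (const_series c) n -
    pser_product N \<mu> (const_series a) (pser_product N \<nu> (const_series b) (const_series c)) n"
  by (simp add: pser_product_const_right[OF \<mu> \<open>n \<le> N\<close>] pser_product_const_left[OF \<mu> \<open>n \<le> N\<close>]
      assoc_coeff_def associator_def case_prod_unfold sum_subtractf)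
    (intro arg_cong2[where f = minus] sum.cong refl;
      use \<open>n \<le> N\<close> in \<open>auto simp: pser_product_const_const[OF \<nu>]\<close>)

text \<open>
  Two cosets agree exactly when the coefficients up to \<open>t\<^sup>N\<close> agree; on the cosets of constant series
  the coefficients of the two sides of an axiom differ by the sums that define \<^const>\<open>assoc_coeff\<close>.
\<close>

lemma compatible_trunc_imp_coeffs:
  assumes vs: "vector_space scale"
    and comp: "compatible_algebra (trunc_ring N) (trunc_module scale N)
       (trunc_product scale N \<mu>1) (trunc_product scale N \<mu>2)"
    and \<mu>1: "\<And>i. i \<le> N \<Longrightarrow> biadditive (\<mu>1 i)" and \<mu>2: "\<And>i. i \<le> N \<Longrightarrow> biadditive (\<mu>2 i)" and "n \<le> N"
  shows "assoc_coeff \<mu>1 \<mu>1 n a b c = 0" "assoc_coeff \<mu>2 \<mu>2 n a b c = 0"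
    "assoc_coeff \<mu>1 \<mu>2 n a b c + assoc_coeff \<mu>2 \<mu>1 n a b c = 0"
proof -
  interpret compatible_algebra "trunc_ring N" "trunc_module scale N"
    "trunc_product scale N \<mu>1" "trunc_product scale N \<mu>2" by (rule comp)
  note simps = trunc_product_jet_class[OF vs bilinear1] trunc_product_jet_class[OF vs bilinear2]
    trunc_add[OF vs] jet_class_eq_iff
  have carr: "jet_class N x \<in> carrier (trunc_module scale N)" for x
    by (simp add: trunc_carrier[OF vs])
  note * = carr[of "const_series a"] carr[of "const_series b"] carr[of "const_series c"]
  show "assoc_coeff \<mu>1 \<mu>1 n a b c = 0"
    using assoc1[OF *] \<open>n \<le> N\<close> unfolding simps by (simp add: assoc_coeff_pser_product[OF \<mu>1 \<mu>1])
  show "assoc_coeff \<mu>2 \<mu>2 n a b c = 0"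
    using assoc2[OF *] \<open>n \<le> N\<close> unfolding simps by (simp add: assoc_coeff_pser_product[OF \<mu>2 \<mu>2])
  show "assoc_coeff \<mu>1 \<mu>2 n a b c + assoc_coeff \<mu>2 \<mu>1 n a b c = 0"
    using compatible[OF *] \<open>n \<le> N\<close> unfolding simps
    by (simp add: assoc_coeff_pser_product[OF \<mu>1 \<mu>2] assoc_coeff_pser_product[OF \<mu>2 \<mu>1] algebra_simps)
qed


lemma hochschild_uminus:
  assumes "biadditive f"
  shows "hochschild f (\<lambda>a b c. - g a b c) a b c d = - hochschild f g a b c d"
  by (simp add: hochschild_def biadditiveD[OF assms])

section \<open>The obstruction as a sum of associators\<close>

lemma bilinear_product_module_of:
  "bilinear_product (ring_of_type_algebra :: 'k ring) (module_of scale) f \<longleftrightarrow>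
    (\<forall>x y z. f (x + y) z = f x z + f y z \<and> f z (x + y) = f z x + f z y) \<and>
    (\<forall>(r :: 'k::field) x y. f (scale r x) y = scale r (f x y) \<and> f x (scale r y) = scale r (f x y))"
  by (simp add: bilinear_product_def module_of_def ring_of_type_algebra_def)

lemma bilinear_product_imp_biadditive:
  assumes "bilinear_product (ring_of_type_algebra :: 'k::field ring) (module_of scale) f"
  shows "biadditive f"
  using assms by (simp add: bilinear_product_module_of biadditive_def additive_def)

lemma gerst_bracket_1_1:
  assumes "vector_space scale"
  shows "gerst_bracket scale 1 1 f g [a, b, c] =
    associator (\<lambda>x y. f [x, y]) (\<lambda>x y. g [x, y]) a b c +
    associator (\<lambda>x y. g [x, y]) (\<lambda>x y. f [x, y]) a b c"
proof -
  interpret vector_space scale by fact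
  have "{1..2::nat} = {1, 2}" by auto
  then show ?thesis
    by (simp add: gerst_bracket_def gerst_circ_def associator_def)
qed

lemma gerst_bracket_1_2:
  assumes "vector_space scale"
  shows "gerst_bracket scale 1 2 f g [a, b, c, d] =
    hochschild (\<lambda>x y. f [x, y]) (\<lambda>x y z. g [x, y, z]) a b c d"
proof -
  interpret vector_space scale by fact
  have "{1..2::nat} = {1, 2}" "{1..3::nat} = {1, 2, 3}" by auto
  then show ?thesis
    by (simp add: gerst_bracket_def gerst_circ_def hochschild_def numeral_eq_Suc algebra_simps)
qed

text \<open>
  Both deformations as one family: the index \<open>(i, p)\<close> stands for the coefficient of \<open>t\<^sup>i\<close> in the \<open>p\<close>-th
  product.
\<close>

definition family_product ::
  "(nat \<Rightarrow> 'a \<Rightarrow> 'a \<Rightarrow> 'a) \<Rightarrow> (nat \<Rightarrow> 'a \<Rightarrow> 'a \<Rightarrow> 'a) \<Rightarrow> nat \<times> nat \<Rightarrow> 'a \<Rightarrow> 'a \<Rightarrow> 'a::ab_group_add" where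
  "family_product \<mu>1 \<mu>2 x a b = cochain_pair (\<mu>1 (fst x)) (\<mu>2 (fst x)) (snd x) [a, b]"

text \<open>
  The pairs of total degree \<open>n\<close> in \<open>t\<close> that contribute to position \<open>k\<close> of a tuple; the shift to \<open>k + 1\<close> is the
  one in \<^const>\<open>compat_bracket\<close>, where positions start at \<open>1\<close>.
\<close>

definition index_pairs :: "nat \<Rightarrow> nat \<Rightarrow> nat \<Rightarrow> ((nat \<times> nat) \<times> (nat \<times> nat)) set" where
  "index_pairs N n k = {(x, y). x \<in> {..N} \<times> {1, 2} \<and> y \<in> {..N} \<times> {1, 2} \<and>
     fst x + fst y = n \<and> snd x + snd y = k + 1}"

lemma sum_index_pairs:
  "(\<Sum>(x, y)\<in>index_pairs N n k. h x y) =
   (\<Sum>(i, j)\<in>{(i, j). i \<le> N \<and> j \<le> N \<and> i + j = n}.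
      \<Sum>(q, r)\<in>{(q, r). q \<in> {1, 2} \<and> r \<in> {1, 2} \<and> q + r = k + 1}. h (i, q) (j, r))"
proof -
  have "(\<Sum>(x, y)\<in>index_pairs N n k. h x y) =
    (\<Sum>((i, j), (q, r)) \<in> {(i, j). i \<le> N \<and> j \<le> N \<and> i + j = n} \<times>
      {(q, r). q \<in> {1, 2} \<and> r \<in> {1, 2} \<and> q + r = k + 1}. h (i, q) (j, r))"
    by (rule sum.reindex_bij_witness[of _ "\<lambda>((i, j), (q, r)). ((i, q), (j, r))"
          "\<lambda>((i, q), (j, r)). ((i, j), (q, r))"])
      (auto simp: index_pairs_def)
  then show ?thesis
    by (simp add: sum.cartesian_product case_prod_unfold)
qed

text \<open>
  The bracket of two products is the sum of their two mixed associators. Exchanging the two indices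
  shows that both contribute equally, which cancels the factor \<open>1 / 2\<close>.
\<close>

lemma obstruction_eq:
  assumes "vector_space scale"
  shows "obstruction scale N \<mu>1 \<mu>2 k [a, b, c] =
    - (\<Sum>(x, y)\<in>index_pairs N (N + 1) k.
        associator (family_product \<mu>1 \<mu>2 x) (family_product \<mu>1 \<mu>2 y) a b c)"
    (is "_ = - ?S")
proof -
  interpret vector_space scale by fact
  let ?h = "\<lambda>x y. associator (family_product \<mu>1 \<mu>2 x) (family_product \<mu>1 \<mu>2 y) a b c"
  have range: "{1..1 + 1} = {1, 2::nat}" by auto
  have I: "{(i, j). i + j = N + 1 \<and> 1 \<le> i \<and> 1 \<le> j} = {(i, j). i \<le> N \<and> j \<le> N \<and> i + j = N + 1}"
    by auto
  have "(\<Sum>(i, j) \<in> {(i, j). i + j = N + 1 \<and> i \<ge> 1 \<and> j \<ge> 1}.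
         compat_bracket scale 1 1 (cochain_pair (\<mu>1 i) (\<mu>2 i)) (cochain_pair (\<mu>1 j) (\<mu>2 j))) k [a, b, c]
      = (\<Sum>(x, y)\<in>index_pairs N (N + 1) k. ?h x y + ?h y x)"
    unfolding sum_index_pairs compat_bracket_def range I
    by (simp add: sum_apply gerst_bracket_1_1[OF assms] family_product_def[abs_def] case_prod_unfold
        del: One_nat_def)
  also have "\<dots> = ?S + (\<Sum>(x, y)\<in>index_pairs N (N + 1) k. ?h y x)"
    by (simp add: sum.distrib case_prod_unfold)
  also have "(\<Sum>(x, y)\<in>index_pairs N (N + 1) k. ?h y x) = ?S"
    by (rule sum.reindex_bij_witness[of _ prod.swap prod.swap]) (auto simp: index_pairs_def)
  finally have "obstruction scale N \<mu>1 \<mu>2 k [a, b, c] = scale (- (1 / 2)) (?S + ?S)"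
    by (simp add: obstruction_def)
  also have "\<dots> = scale (- (1 / 2) + - (1 / 2)) ?S"
    by (simp only: scale_right_distrib scale_left_distrib)
  finally show ?thesis by simp
qed

lemma obstruction_eq_0:
  assumes "vector_space scale" and "length xs \<noteq> 3 \<or> k \<notin> {1..3}"
  shows "obstruction scale N \<mu>1 \<mu>2 k xs = 0"
proof -
  interpret vector_space scale by fact
  have "compat_bracket scale 1 1 F G k xs = 0" for F G
    unfolding compat_bracket_def sum_apply
    by (rule sum.neutral) (use assms(2) in \<open>auto simp: gerst_bracket_def gerst_circ_def\<close>)
  then show ?thesis
    by (simp add: obstruction_def sum_apply case_prod_unfold del: One_nat_def)
qed

lemma associator_trilinear:
  fixes scale :: "'k::field \<Rightarrow> 'a::ab_group_add \<Rightarrow> 'a"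
  assumes vs: "vector_space scale"
    and "bilinear_product (ring_of_type_algebra :: 'k ring) (module_of scale) f"
    and "bilinear_product (ring_of_type_algebra :: 'k ring) (module_of scale) g"
  shows "Vector_Spaces.linear scale scale (\<lambda>x. associator f g x b c)"
    "Vector_Spaces.linear scale scale (\<lambda>x. associator f g a x c)"
    "Vector_Spaces.linear scale scale (\<lambda>x. associator f g a b x)"
proof -
  interpret vector_space scale by fact
  interpret vector_space_pair scale scale by unfold_locales
  show "Vector_Spaces.linear scale scale (\<lambda>x. associator f g x b c)"
    "Vector_Spaces.linear scale scale (\<lambda>x. associator f g a x c)"
    "Vector_Spaces.linear scale scale (\<lambda>x. associator f g a b x)"
    using assms by (simp_all add: Vector_Spaces.linear_iff associator_def bilinear_product_module_of
        scale_right_diff_distrib)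
qed

lemma family_product_bilinear:
  fixes scale :: "'k::field \<Rightarrow> 'a::ab_group_add \<Rightarrow> 'a"
  assumes "vector_space scale"
    and "bilinear_product (ring_of_type_algebra :: 'k ring) (module_of scale) (\<mu>1 (fst x))"
    and "bilinear_product (ring_of_type_algebra :: 'k ring) (module_of scale) (\<mu>2 (fst x))"
  shows "bilinear_product (ring_of_type_algebra :: 'k ring) (module_of scale) (family_product \<mu>1 \<mu>2 x)"
proof -
  interpret vector_space scale by fact
  show ?thesis
    using assms(2,3) by (simp add: bilinear_product_module_of family_product_def cochain_pair_def)
qed

text \<open>An associator of bilinear products is linear in each argument, and so are sums of associators.\<close>

lemma obstruction_in_compat_cochains:
  fixes scale :: "'k::field_char_0 \<Rightarrow> 'a::ab_group_add \<Rightarrow> 'a"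
  assumes vs: "vector_space scale"
    and bil1: "\<And>i. i \<le> N \<Longrightarrow> bilinear_product (ring_of_type_algebra :: 'k ring) (module_of scale) (\<mu>1 i)"
    and bil2: "\<And>i. i \<le> N \<Longrightarrow> bilinear_product (ring_of_type_algebra :: 'k ring) (module_of scale) (\<mu>2 i)"
  shows "obstruction scale N \<mu>1 \<mu>2 \<in> compat_cochains scale 3"
proof -
  interpret vector_space scale by fact
  interpret vector_space_pair scale scale by unfold_locales
  note lin = associator_trilinear[OF vs family_product_bilinear[OF vs] family_product_bilinear[OF vs]]
  have "Vector_Spaces.linear scale scale (\<lambda>x. obstruction scale N \<mu>1 \<mu>2 k (xs @ x # ys))"
    if len: "length xs + 1 + length ys = 3" for k xs ys
  proof -
    consider b c where "xs = []" "ys = [b, c]" | a c where "xs = [a]" "ys = [c]"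
      | a b where "xs = [a, b]" "ys = []"
    proof -
      have "length xs = 0 \<and> length ys = 2 \<or> length xs = 1 \<and> length ys = 1 \<or> length xs = 2 \<and> length ys = 0"
        using len by linarith
      then show thesis
        using that by (auto simp: numeral_2_eq_2 length_Suc_conv)
    qed
    then show ?thesis
      by cases (simp_all add: obstruction_eq[OF vs] case_prod_unfold, safe intro!: linear_compose_neg
          linear_compose_sum lin bil1 bil2, auto simp: index_pairs_def)
  qed
  then show ?thesis
    using obstruction_eq_0[OF vs] by (auto simp: compat_cochains_def cochains_def fun_eq_iff)
qed

section \<open>The cocycle condition\<close>

text \<open>
  Position \<open>1\<close> receives only associators within the first product, position \<open>3\<close> only those within the
  second; position \<open>2\<close> receives both mixed ones, which together are the compatibility condition.
\<close>

lemma low_order_associators_cancel: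
  assumes "n \<le> N"
    and "assoc_coeff \<mu>1 \<mu>1 n a b c = 0" "assoc_coeff \<mu>2 \<mu>2 n a b c = 0"
    "assoc_coeff \<mu>1 \<mu>2 n a b c + assoc_coeff \<mu>2 \<mu>1 n a b c = 0"
  shows "(\<Sum>(x, y)\<in>index_pairs N n k.
    associator (family_product \<mu>1 \<mu>2 x) (family_product \<mu>1 \<mu>2 y) a b c) = 0"
proof -
  have I: "{(i, j). i \<le> N \<and> j \<le> N \<and> i + j = n} = {(i, j). i + j = n}"
    using \<open>n \<le> N\<close> by auto
  have family: "(\<lambda>i. family_product \<mu>1 \<mu>2 (i, 1)) = \<mu>1"
    "(\<lambda>i. family_product \<mu>1 \<mu>2 (i, 2)) = \<mu>2"
    by (simp_all add: fun_eq_iff family_product_def cochain_pair_def)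
  let ?Q = "{(q, r). q \<in> {1, 2} \<and> r \<in> {1, 2} \<and> q + r = k + 1}"
  have sum: "(\<Sum>(x, y)\<in>index_pairs N n k.
      associator (family_product \<mu>1 \<mu>2 x) (family_product \<mu>1 \<mu>2 y) a b c) =
    (\<Sum>(q, r)\<in>?Q. assoc_coeff (\<lambda>i. family_product \<mu>1 \<mu>2 (i, q))
      (\<lambda>j. family_product \<mu>1 \<mu>2 (j, r)) n a b c)"
    unfolding sum_index_pairs I assoc_coeff_def unfolding case_prod_unfold by (rule sum.swap)
  have Q: "?Q = (if k = 1 then {(1, 1)} else if k = 2 then {(1, 2), (2, 1)}
      else if k = 3 then {(2, 2)} else {})"
    by auto
  show ?thesis
    unfolding sum Q using assms(2-4)
    by (simp add: family del: One_nat_def)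
qed

text \<open>
  Group the triples of the cubic Jacobi identity by their
  first entry \<open>x\<close>. The remaining pairs have \<open>t\<close>-degree \<open>N + 1 - fst x\<close>, so by \<open>low\<close> only the groups with
  \<open>fst x = 0\<close> survive.
\<close>

lemma hochschild_obstruction_eq_0:
  fixes \<phi> :: "nat \<times> nat \<Rightarrow> 'a::ab_group_add \<Rightarrow> 'a \<Rightarrow> 'a"
  assumes add: "\<And>x. fst x \<le> N \<Longrightarrow> biadditive (\<phi> x)"
    and low: "\<And>n k a b c. n \<le> N \<Longrightarrow>
      (\<Sum>(x, y)\<in>index_pairs N n k. associator (\<phi> x) (\<phi> y) a b c) = 0"
  shows "(\<Sum>(q, r)\<in>{(q, r). q \<in> {1, 2} \<and> r \<in> {1..3} \<and> q + r = K + 1}.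
    hochschild (\<phi> (0, q))
      (\<lambda>a b c. \<Sum>(x, y)\<in>index_pairs N (N + 1) r. associator (\<phi> x) (\<phi> y) a b c) a b c d) = 0"
proof -
  define I where "I = {..N} \<times> {1, 2::nat}"
  \<comment> \<open>The two index shifts add up: a pair at position \<open>r\<close> has \<open>s\<close>-degree \<open>r + 1\<close>, and \<open>snd x + r = K + 1\<close>,
    so the triples have \<open>s\<close>-degree \<open>K + 2\<close>.\<close>
  define T where "T = {(x, y, z). x \<in> I \<and> y \<in> I \<and> z \<in> I \<and>
    fst x + fst y + fst z = N + 1 \<and> snd x + snd y + snd z = K + 2}"
  \<comment> \<open>The labels of the groups: the first entry of a triple and the position of the remaining pair.\<close>
  define U where "U = {(x, r). x \<in> I \<and> r \<in> {1..3} \<and> snd x + r = K + 1}"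
  let ?h = "\<lambda>x y z. hochschild (\<phi> x) (associator (\<phi> y) (\<phi> z)) a b c d"
  let ?H = "\<lambda>x r. hochschild (\<phi> x)
    (\<lambda>a b c. \<Sum>(y, z)\<in>index_pairs N (N + 1 - fst x) r. associator (\<phi> y) (\<phi> z) a b c) a b c d"
  have finU: "finite U"
    by (rule finite_subset[of _ "I \<times> {1..3}"]) (auto simp: U_def I_def)
  have finP: "finite (index_pairs N n r)" for n r
    by (rule finite_subset[of _ "I \<times> I"]) (auto simp: index_pairs_def I_def)
  have H: "?H x r = (\<Sum>(y, z)\<in>index_pairs N (N + 1 - fst x) r. ?h x y z)" if "fst x \<le> N" for x r
    using hochschild_sum[OF add[OF that]] by (simp add: case_prod_unfold)
  have H0: "?H x r = 0" if "fst x \<le> N" "fst x \<noteq> 0" for x r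
  proof -
    have "N + 1 - fst x \<le> N" using that by simp
    then show ?thesis
      using add[OF that(1)] by (simp only: low) (simp add: hochschild_def biadditiveD)
  qed
  have "0 = (\<Sum>(x, y, z)\<in>T. ?h x y z)"
    by (rule hochschild_associator_sum_eq_0[symmetric]) (auto simp: T_def I_def intro: add)
  also have "\<dots> = (\<Sum>(p, y, z)\<in>(SIGMA p:U. index_pairs N (N + 1 - fst (fst p)) (snd p)). ?h (fst p) y z)"
    by (rule sum.reindex_bij_witness[of _ "\<lambda>(p, y, z). (fst p, y, z)"
          "\<lambda>(x, y, z). ((x, snd y + snd z - 1), y, z)"])
      (auto simp: T_def U_def I_def index_pairs_def)
  also have "\<dots> = (\<Sum>p\<in>U. \<Sum>(y, z)\<in>index_pairs N (N + 1 - fst (fst p)) (snd p). ?h (fst p) y z)"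
    by (subst sum.Sigma) (auto simp: finU finP case_prod_unfold)
  also have "\<dots> = (\<Sum>(x, r)\<in>U. ?H x r)"
  proof (rule sum.cong[OF refl])
    fix p assume "p \<in> U"
    then have "fst (fst p) \<le> N" by (auto simp: U_def I_def)
    then show "(\<Sum>(y, z)\<in>index_pairs N (N + 1 - fst (fst p)) (snd p). ?h (fst p) y z) =
        (case p of (x, r) \<Rightarrow> ?H x r)"
      using H[of "fst p" "snd p"] by (simp add: case_prod_unfold)
  qed
  also have "\<dots> = (\<Sum>(x, r)\<in>{p \<in> U. fst (fst p) = 0}. ?H x r)"
  proof (rule sum.mono_neutral_right[OF finU])
    show "\<forall>p\<in>U - {p \<in> U. fst (fst p) = 0}. (case p of (x, r) \<Rightarrow> ?H x r) = 0"
    proof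
      fix p assume p: "p \<in> U - {p \<in> U. fst (fst p) = 0}"
      obtain x r where "p = (x, r)" by fastforce
      moreover from this p have "fst x \<le> N" "fst x \<noteq> 0"
        by (auto simp: U_def I_def)
      ultimately show "(case p of (x, r) \<Rightarrow> ?H x r) = 0"
        using H0 by (simp only: prod.case)
    qed
  qed auto
  also have "\<dots> = (\<Sum>(q, r)\<in>{(q, r). q \<in> {1, 2} \<and> r \<in> {1..3} \<and> q + r = K + 1}.
    hochschild (\<phi> (0, q))
      (\<lambda>a b c. \<Sum>(x, y)\<in>index_pairs N (N + 1) r. associator (\<phi> x) (\<phi> y) a b c) a b c d)"
    by (rule sum.reindex_bij_witness[of _ "\<lambda>(q, r). ((0, q), r)" "\<lambda>(x, r). (snd x, r)"])
      (auto simp: U_def I_def)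
  finally show ?thesis ..
qed

lemma compat_coboundary_3_apply:
  assumes "vector_space scale"
  shows "compat_coboundary scale m1 m2 3 F K [a, b, c, d] =
    (\<Sum>(q, r)\<in>{(q, r). q \<in> {1, 2} \<and> r \<in> {1..3} \<and> q + r = K + 1}.
      hochschild (\<lambda>x y. cochain_pair m1 m2 q [x, y]) (\<lambda>x y z. F r [x, y, z]) a b c d)"
proof -
  interpret vector_space scale by fact
  have *: "{1..1 + 1} = {1, 2::nat}" "3 - 1 = (2::nat)" "2 + 1 = (3::nat)" by auto
  show ?thesis
    unfolding compat_coboundary_def compat_bracket_def * sum_apply case_prod_unfold
      gerst_bracket_1_2[OF assms] by simp
qed

lemma compat_coboundary_3_eq_0:
  assumes "vector_space scale" "length xs \<noteq> 4"
  shows "compat_coboundary scale m1 m2 3 F K xs = 0"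
proof -
  interpret vector_space scale by fact
  show ?thesis
    using assms(2) by (simp add: compat_coboundary_def compat_bracket_def sum_apply
        case_prod_unfold gerst_bracket_def gerst_circ_def)
qed

theorem proposition4p8:
  fixes scale :: "'k::field_char_0 \<Rightarrow> 'a::ab_group_add \<Rightarrow> 'a"
    and Basis :: "'a set"
    and m1 m2 :: "'a \<Rightarrow> 'a \<Rightarrow> 'a"
    and N :: nat
    and \<mu>1 \<mu>2 :: "nat \<Rightarrow> 'a \<Rightarrow> 'a \<Rightarrow> 'a"
  assumes "finite_dimensional_vector_space scale Basis"
    and "compatible_algebra (ring_of_type_algebra :: 'k ring) (module_of scale) m1 m2"
    and "N \<ge> 1"
    and "order_deformation scale m1 m2 N \<mu>1 \<mu>2"
  shows "obstruction scale N \<mu>1 \<mu>2 \<in> compat_cochains scale 3 \<and>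
    compat_coboundary scale m1 m2 3 (obstruction scale N \<mu>1 \<mu>2) = 0"
proof
  interpret finite_dimensional_vector_space scale Basis by fact
  have vs: "vector_space scale" by unfold_locales
  have bil1: "bilinear_product (ring_of_type_algebra :: 'k ring) (module_of scale) (\<mu>1 i)"
    and bil2: "bilinear_product (ring_of_type_algebra :: 'k ring) (module_of scale) (\<mu>2 i)"
    if "i \<le> N" for i
    using assms(4) that by (auto simp: order_deformation_def)
  have zero: "\<mu>1 0 = m1" "\<mu>2 0 = m2"
    and trunc: "compatible_algebra (trunc_ring N) (trunc_module scale N)
      (trunc_product scale N \<mu>1) (trunc_product scale N \<mu>2)"
    using assms(4) by (auto simp: order_deformation_def)
  show "obstruction scale N \<mu>1 \<mu>2 \<in> compat_cochains scale 3"
    using vs bil1 bil2 by (rule obstruction_in_compat_cochains)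
  let ?\<phi> = "family_product \<mu>1 \<mu>2"
  note biadd1 = bil1[THEN bilinear_product_imp_biadditive]
  note biadd2 = bil2[THEN bilinear_product_imp_biadditive]
  have biadd: "biadditive (?\<phi> x)" if "fst x \<le> N" for x
    by (intro bilinear_product_imp_biadditive[of scale] family_product_bilinear vs bil1 bil2 that)
  have low: "(\<Sum>(x, y)\<in>index_pairs N n k. associator (?\<phi> x) (?\<phi> y) a b c) = 0" if "n \<le> N" for n k a b c
    using that compatible_trunc_imp_coeffs[OF vs trunc biadd1 biadd2 that]
    by (intro low_order_associators_cancel)
  have "compat_coboundary scale m1 m2 3 (obstruction scale N \<mu>1 \<mu>2) K [a, b, c, d] = 0" for K a b c d
  proof -
    have base: "(\<lambda>x y. cochain_pair m1 m2 q [x, y]) = ?\<phi> (0, q)" for q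
      by (simp add: family_product_def[abs_def] zero)
    show ?thesis
      unfolding compat_coboundary_3_apply[OF vs] base obstruction_eq[OF vs]
      using hochschild_obstruction_eq_0[OF biadd low]
      by (simp add: hochschild_uminus biadd case_prod_unfold sum_negf)
  qed
  then have "compat_coboundary scale m1 m2 3 (obstruction scale N \<mu>1 \<mu>2) K xs = 0" for K xs
    using compat_coboundary_3_eq_0[OF vs]
    by (cases "length xs = 4") (auto simp: numeral_eq_Suc length_Suc_conv)
  then show "compat_coboundary scale m1 m2 3 (obstruction scale N \<mu>1 \<mu>2) = 0"
    by (simp add: fun_eq_iff)
qed

end
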